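(* Let $h: J\to[0,\infty)$ and $f:I\to(0,\infty)$. (i) If $h$ is superadditive and $f$ is $\mathrm{G_tA_h}$-convex, then for all $x,y,z\in I$ $$f(\sqrt{xz})+f(\sqrt{yz})+f(\sqrt{xy})\le h(3/2)\, f(\sqrt[3]{xyz})+h(1/2)\left[f(x)+f(y)+f(z)\right].$$ (ii) If $h$ is subadditive and $f$ is $\mathrm{G_tA_h}$-concave, then the reverse inequality ($\ge$) holds for all $x,y,z\in I$.
   Context: $I\subseteq(0,\infty)$ is an interval. $J$ is a real interval containing $(0,1)$ and the point $3/2$. The function $h:J\to[0,\infty)$ is such that $h(t)$ and $h(1-t)$ are never both zero. $h$ is superadditive (resp. subadditive) if $h(s+t)\ge h(s)+h(t)$ (resp. $\le$) whenever $s,t,s+t\in J$. A function $f:I\to(0,\infty)$ is $\mathrm{G_tA_h}$-convex if $$f(\alpha^t\beta^{1-t})\le h(t)f(\alpha)+h(1-t)f(\beta)$$ for all $\alpha,\beta\in I$ and all $t\in[0,1]$ with $t,1-t\in J$; it is $\mathrm{G_tA_h}$-concave if the reverse inequality ($\ge$) holds for all such $\alpha,\beta,t$. *)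

theory Defs
  imports "HOL-Analysis.Analysis"
begin

definition superadditive_on :: "real set \<Rightarrow> (real \<Rightarrow> real) \<Rightarrow> bool" where
  "superadditive_on J h \<longleftrightarrow>
     (\<forall>s\<in>J. \<forall>t\<in>J. s + t \<in> J \<longrightarrow> h (s + t) \<ge> h s + h t)"

definition subadditive_on :: "real set \<Rightarrow> (real \<Rightarrow> real) \<Rightarrow> bool" where
  "subadditive_on J h \<longleftrightarrow>
     (\<forall>s\<in>J. \<forall>t\<in>J. s + t \<in> J \<longrightarrow> h (s + t) \<le> h s + h t)"

text \<open>
  Partial functions \<open>h : J \<rightarrow> [0, \<infinity>)\<close> and \<open>f : I \<rightarrow> (0, \<infinity>)\<close> are modelled by total functions
  whose values outside \<open>J\<close> and \<open>I\<close> are never referred to. Only the case \<open>I \<subseteq> (0, \<infinity>)\<close> is meant,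
  where \<open>powr\<close> is the usual real power.
\<close>

definition GtAh_convex_on ::
    "real set \<Rightarrow> real set \<Rightarrow> (real \<Rightarrow> real) \<Rightarrow> (real \<Rightarrow> real) \<Rightarrow> bool" where
  "GtAh_convex_on I J h f \<longleftrightarrow>
     (\<forall>\<alpha>\<in>I. \<forall>\<beta>\<in>I. \<forall>t\<in>{0..1}. t \<in> J \<and> 1 - t \<in> J \<longrightarrow>
        f (\<alpha> powr t * \<beta> powr (1 - t)) \<le> h t * f \<alpha> + h (1 - t) * f \<beta>)"

definition GtAh_concave_on ::
    "real set \<Rightarrow> real set \<Rightarrow> (real \<Rightarrow> real) \<Rightarrow> (real \<Rightarrow> real) \<Rightarrow> bool" where
  "GtAh_concave_on I J h f \<longleftrightarrow>
     (\<forall>\<alpha>\<in>I. \<forall>\<beta>\<in>I. \<forall>t\<in>{0..1}. t \<in> J \<and> 1 - t \<in> J \<longrightarrow>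
        f (\<alpha> powr t * \<beta> powr (1 - t)) \<ge> h t * f \<alpha> + h (1 - t) * f \<beta>)"

end

theory Submission
  imports Defs
begin

text \<open>
  In logarithmic coordinates \<open>g = f \<circ> exp\<close> the claim is an \<open>h\<close>-weighted form of Popoviciu's
  inequality. Let \<open>c\<close> be the one of the three points that lies farthest from their mean \<open>m\<close>. The
  deviations from \<open>m\<close> add up to zero, so the other two points lie opposite to \<open>c\<close>, and the
  midpoints \<open>(a + c)/2\<close> and \<open>(b + c)/2\<close> both lie between \<open>m\<close> and \<open>c\<close>: they are
  \<open>s m + (1 - s) c\<close> and \<open>t m + (1 - t) c\<close> with \<open>s, t \<in> [1/2, 1]\<close> and \<open>s + t = 3/2\<close>. Adding the two
  convexity inequalities gives the coefficients \<open>h s + h t \<le> h (3/2)\<close> of \<open>g m\<close> and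
  \<open>h (1 - s) + h (1 - t) \<le> h (1/2)\<close> of \<open>g c\<close>; the third midpoint \<open>(a + b)/2\<close> is estimated directly
  by \<open>h (1/2) (g a + g b)\<close>.

  If \<open>s = 1\<close> or \<open>t = 1\<close>, the point \<open>0\<close> may lie outside \<open>J\<close>, and \<open>G\<^sub>tA\<^sub>h\<close>-convexity then says
  nothing about these parameters. The remedy is to use the weight \<open>h(0 := 0)\<close>. It is still
  superadditive on \<open>[0, 3/2]\<close>, and what convexity has to say at \<open>1\<close> and \<open>0\<close> becomes \<open>g \<le> h 1 * g\<close>. This is
  true, because convexity with equal points gives \<open>1 \<le> 2 h (1/2) \<le> h 1\<close>.

  The concave statement is the same inequality for \<open>- f\<close>, since superadditivity is used only in the
  form \<open>(h s + h t) * g u \<le> h (s + t) * g u\<close>, which for negative \<open>g\<close> follows from subadditivity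
  (lemma \<open>weighted_popoviciu\<close>); the bound at \<open>1\<close> turns into \<open>h 1 \<le> 2 h (1/2) \<le> 1\<close>.
\<close>

text \<open>
  The parameter \<open>l\<close> says in which ratio the largest deviation \<open>r\<close> is balanced by the other two.
\<close>

lemma zero_sum_balance:
  fixes p q r :: real
  assumes "p + q + r = 0" "\<bar>p\<bar> \<le> \<bar>r\<bar>" "\<bar>q\<bar> \<le> \<bar>r\<bar>"
  obtains l where "0 \<le> l" "l \<le> 1" "p = - l * r" "q = - (1 - l) * r"
proof (cases "r = 0")
  case True
  then show ?thesis using assms that[of 0] by auto
next
  case False
  show ?thesis
  proof (rule that[of "- p / r"])
    show "0 \<le> - p / r" "- p / r \<le> 1"
      using False assms by (cases "r > 0"; auto simp: divide_simps)+
    show "p = - (- p / r) * r" "q = - (1 - (- p / r)) * r"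
      using False assms(1) by (simp_all add: left_diff_distrib)
  qed
qed

text \<open>
  The sign of \<open>g\<close> is left open: the hypothesis on \<open>k\<close> means superadditivity where \<open>g\<close> is positive and
  subadditivity where it is negative.
\<close>

lemma weighted_popoviciu_farthest:
  fixes g k :: "real \<Rightarrow> real"
  assumes conv: "\<And>u v s. u \<in> C \<Longrightarrow> v \<in> C \<Longrightarrow> 0 \<le> s \<Longrightarrow> s \<le> 1 \<Longrightarrow>
      g (s * u + (1 - s) * v) \<le> k s * g u + k (1 - s) * g v"
    and add: "\<And>u s t. u \<in> C \<Longrightarrow> 0 \<le> s \<Longrightarrow> s \<le> 1 \<Longrightarrow> 0 \<le> t \<Longrightarrow> t \<le> 1 \<Longrightarrow> s + t \<in> {1/2, 3/2} \<Longrightarrow>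
      (k s + k t) * g u \<le> k (s + t) * g u"
    and C: "a \<in> C" "b \<in> C" "c \<in> C" "m \<in> C"
    and m: "m = (a + b + c) / 3"
    and far: "\<bar>a - m\<bar> \<le> \<bar>c - m\<bar>" "\<bar>b - m\<bar> \<le> \<bar>c - m\<bar>"
  shows "g ((a + c) / 2) + g ((b + c) / 2) + g ((a + b) / 2)
      \<le> k (3/2) * g m + k (1/2) * (g a + g b + g c)"
proof -
  have "(a - m) + (b - m) + (c - m) = 0" using m by simp
  then obtain l where l: "0 \<le> l" "l \<le> 1" and am: "a - m = - l * (c - m)"
      and bm: "b - m = - (1 - l) * (c - m)"
    using far zero_sum_balance by blast
  \<comment> \<open>The midpoint of \<open>c\<close> with \<open>a\<close> deviates from \<open>m\<close> by \<open>(1 - l)/2\<close> times \<open>c - m\<close>, which is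
    \<open>1 - s\<close> times it; likewise for \<open>b\<close> and \<open>t\<close>.\<close>
  define s t where "s = (1 + l) / 2" and "t = (2 - l) / 2"
  have st: "0 \<le> s" "s \<le> 1" "0 \<le> t" "t \<le> 1" "s + t = 3/2" "(1 - s) + (1 - t) = 1/2"
    using l by (auto simp: s_def t_def field_simps)
  have mid: "(a + c) / 2 = s * m + (1 - s) * c" "(b + c) / 2 = t * m + (1 - t) * c"
    using am bm by (auto simp: s_def t_def field_simps)
  have "g ((a + c) / 2) \<le> k s * g m + k (1 - s) * g c"
      "g ((b + c) / 2) \<le> k t * g m + k (1 - t) * g c"
    unfolding mid using conv C st by blast+
  moreover have "(k s + k t) * g m \<le> k (3/2) * g m"
    using add[of m s t] C st by simp
  moreover have "(k (1 - s) + k (1 - t)) * g c \<le> k (1/2) * g c"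
    using add[of c "1 - s" "1 - t"] C st by simp
  moreover have "g ((a + b) / 2) \<le> k (1/2) * g a + k (1/2) * g b"
    using conv[of a b "1/2"] C by (simp add: field_simps)
  ultimately show ?thesis by (simp add: algebra_simps)
qed

lemma weighted_popoviciu:
  fixes g k :: "real \<Rightarrow> real"
  assumes "is_interval C"
    and conv: "\<And>u v s. u \<in> C \<Longrightarrow> v \<in> C \<Longrightarrow> 0 \<le> s \<Longrightarrow> s \<le> 1 \<Longrightarrow>
      g (s * u + (1 - s) * v) \<le> k s * g u + k (1 - s) * g v"
    and add: "\<And>u s t. u \<in> C \<Longrightarrow> 0 \<le> s \<Longrightarrow> s \<le> 1 \<Longrightarrow> 0 \<le> t \<Longrightarrow> t \<le> 1 \<Longrightarrow> s + t \<in> {1/2, 3/2} \<Longrightarrow>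
      (k s + k t) * g u \<le> k (s + t) * g u"
    and C: "a \<in> C" "b \<in> C" "c \<in> C"
  shows "g ((a + c) / 2) + g ((b + c) / 2) + g ((a + b) / 2)
      \<le> k (3/2) * g ((a + b + c) / 3) + k (1/2) * (g a + g b + g c)"
proof -
  define m where "m = (a + b + c) / 3"
  have "min a (min b c) \<in> C" "max a (max b c) \<in> C"
    using C by (auto simp: min_def max_def)
  moreover have "min a (min b c) \<le> m" "m \<le> max a (max b c)"
    by (auto simp: m_def min_def max_def)
  ultimately have mC: "m \<in> C"
    using \<open>is_interval C\<close> unfolding is_interval_1 by blast
  note far = weighted_popoviciu_farthest[where C = C and g = g and k = k, OF conv add]
  consider "\<bar>a - m\<bar> \<le> \<bar>c - m\<bar>" "\<bar>b - m\<bar> \<le> \<bar>c - m\<bar>"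
    | "\<bar>a - m\<bar> \<le> \<bar>b - m\<bar>" "\<bar>c - m\<bar> \<le> \<bar>b - m\<bar>"
    | "\<bar>b - m\<bar> \<le> \<bar>a - m\<bar>" "\<bar>c - m\<bar> \<le> \<bar>a - m\<bar>"
    by linarith
  then show ?thesis
  proof cases
    case 1
    then show ?thesis using far[of a b c m] C mC by (simp add: m_def)
  next
    case 2
    then show ?thesis using far[of a c b m] C mC by (simp add: m_def add_ac)
  next
    case 3
    then show ?thesis using far[of b c a m] C mC by (simp add: m_def add_ac)
  qed
qed

text \<open>
  The passage from arithmetic to geometric means is the substitution \<open>x = exp u\<close>.
\<close>

lemma weighted_popoviciu_geometric:
  fixes f k :: "real \<Rightarrow> real"
  assumes I: "is_interval I" "I \<subseteq> {0<..}"
    and conv: "\<And>\<alpha> \<beta> s. \<alpha> \<in> I \<Longrightarrow> \<beta> \<in> I \<Longrightarrow> 0 \<le> s \<Longrightarrow> s \<le> 1 \<Longrightarrow>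
      f (\<alpha> powr s * \<beta> powr (1 - s)) \<le> k s * f \<alpha> + k (1 - s) * f \<beta>"
    and add: "\<And>\<alpha> s t. \<alpha> \<in> I \<Longrightarrow> 0 \<le> s \<Longrightarrow> s \<le> 1 \<Longrightarrow> 0 \<le> t \<Longrightarrow> t \<le> 1 \<Longrightarrow> s + t \<in> {1/2, 3/2} \<Longrightarrow>
      (k s + k t) * f \<alpha> \<le> k (s + t) * f \<alpha>"
    and xyz: "x \<in> I" "y \<in> I" "z \<in> I"
  shows "f (sqrt (x * z)) + f (sqrt (y * z)) + f (sqrt (x * y))
      \<le> k (3/2) * f (root 3 (x * y * z)) + k (1/2) * (f x + f y + f z)"
proof -
  let ?C = "{u. exp u \<in> I}"
  have pos: "x > 0" "y > 0" "z > 0" using I xyz by auto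
  have sqrt_exp: "exp ((ln v + ln w) / 2) = sqrt (v * w)" if "v > 0" "w > 0" for v w :: real
  proof (rule real_sqrt_unique[symmetric])
    have "(exp ((ln v + ln w) / 2))\<^sup>2 = exp (ln v + ln w)"
      by (simp add: power2_eq_square flip: exp_add)
    then show "(exp ((ln v + ln w) / 2))\<^sup>2 = v * w" using that by (simp add: exp_add)
  qed simp
  have root_exp: "exp ((ln x + ln y + ln z) / 3) = root 3 (x * y * z)"
  proof (rule real_root_pos_unique[symmetric])
    have "exp (w / 3) ^ 3 = exp w" for w :: real
      by (simp flip: exp_of_nat_mult)
    then show "(exp ((ln x + ln y + ln z) / 3)) ^ 3 = x * y * z" using pos by (simp only: exp_add exp_ln)
  qed simp_all
  have "is_interval ?C"
    unfolding is_interval_1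
  proof (intro ballI allI impI)
    fix u v w assume "u \<in> ?C" "v \<in> ?C" "u \<le> w \<and> w \<le> v"
    then show "w \<in> ?C" using mem_is_interval_1_I[OF I(1), of "exp u" "exp v" "exp w"] by simp
  qed
  moreover have "f (exp (s * u + (1 - s) * v)) \<le> k s * f (exp u) + k (1 - s) * f (exp v)"
    if "u \<in> ?C" "v \<in> ?C" "0 \<le> s" "s \<le> 1" for u v s
    using conv[of "exp u" "exp v" s] that by (simp add: powr_def exp_add)
  ultimately have "f (exp ((ln x + ln z) / 2)) + f (exp ((ln y + ln z) / 2)) + f (exp ((ln x + ln y) / 2))
      \<le> k (3/2) * f (exp ((ln x + ln y + ln z) / 3))
        + k (1/2) * (f (exp (ln x)) + f (exp (ln y)) + f (exp (ln z)))"
    by (rule weighted_popoviciu[where g = "\<lambda>u. f (exp u)"]) (use add xyz pos in auto)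
  then show ?thesis
    unfolding root_exp using pos by (simp add: sqrt_exp)
qed

theorem theorem5:
  fixes I J :: "real set" and h f :: "real \<Rightarrow> real"
  assumes "is_interval I" and "I \<subseteq> {0<..}"
    and "is_interval J" and "{0<..<1} \<subseteq> J" and "3/2 \<in> J"
    and "h \<in> J \<rightarrow> {0..}"
    and "\<And>t. t \<in> J \<Longrightarrow> 1 - t \<in> J \<Longrightarrow> \<not> (h t = 0 \<and> h (1 - t) = 0)"
    and "f \<in> I \<rightarrow> {0<..}"
  shows "(superadditive_on J h \<and> GtAh_convex_on I J h f \<longrightarrow>
           (\<forall>x\<in>I. \<forall>y\<in>I. \<forall>z\<in>I.
              f (sqrt (x * z)) + f (sqrt (y * z)) + f (sqrt (x * y))
                \<le> h (3/2) * f (root 3 (x * y * z)) + h (1/2) * (f x + f y + f z))) \<and>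
         (subadditive_on J h \<and> GtAh_concave_on I J h f \<longrightarrow>
           (\<forall>x\<in>I. \<forall>y\<in>I. \<forall>z\<in>I.
              f (sqrt (x * z)) + f (sqrt (y * z)) + f (sqrt (x * y))
                \<ge> h (3/2) * f (root 3 (x * y * z)) + h (1/2) * (f x + f y + f z)))"
proof (intro conjI impI ballI)
  have J: "t \<in> J" if "0 < t" "t \<le> 3/2" for t
  proof -
    have "min t (1/2) \<in> J" using assms(4) that by (auto simp: min_def subset_iff)
    moreover have "min t (1/2) \<le> t" by simp
    ultimately show ?thesis using assms(3,5) that unfolding is_interval_1 by blast
  qed
  have fpos: "f u > 0" if "u \<in> I" for u using assms(8) that by auto
  have self: "u powr (1/2) * u powr (1/2) = u" if "u \<in> I" for u
    using assms(2) that by (auto simp flip: powr_add)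
  define k where "k = h(0 := 0)"
  {
    fix x y z
    assume hyp: "superadditive_on J h \<and> GtAh_convex_on I J h f" and xyz: "x \<in> I" "y \<in> I" "z \<in> I"
    have super: "h s + h t \<le> h (s + t)" if "0 < s" "0 < t" "s + t \<le> 3/2" for s t
      using hyp J that unfolding superadditive_on_def by simp
    have conv: "f (\<alpha> powr s * \<beta> powr (1 - s)) \<le> h s * f \<alpha> + h (1 - s) * f \<beta>"
      if "\<alpha> \<in> I" "\<beta> \<in> I" "0 < s" "s < 1" for \<alpha> \<beta> s
      using hyp J that unfolding GtAh_convex_on_def by simp
    have "1 * f x \<le> (2 * h (1/2)) * f x"
      using conv[of x x "1/2"] xyz self[of x] by (simp add: algebra_simps)
    then have "1 \<le> 2 * h (1/2)" using fpos[of x] xyz mult_le_cancel_right_pos by blast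
    then have h1: "1 \<le> h 1" using super[of "1/2" "1/2"] by simp
    have "f (sqrt (x * z)) + f (sqrt (y * z)) + f (sqrt (x * y))
        \<le> k (3/2) * f (root 3 (x * y * z)) + k (1/2) * (f x + f y + f z)"
    proof (rule weighted_popoviciu_geometric[OF assms(1,2)])
      fix \<alpha> \<beta> s :: real assume *: "\<alpha> \<in> I" "\<beta> \<in> I" "0 \<le> s" "s \<le> 1"
      then have "\<alpha> > 0" "\<beta> > 0" using assms(2) by auto
      consider "s = 0" | "s = 1" | "0 < s" "s < 1" using * by linarith
      then show "f (\<alpha> powr s * \<beta> powr (1 - s)) \<le> k s * f \<alpha> + k (1 - s) * f \<beta>"
        using * conv[of \<alpha> \<beta> s] \<open>\<alpha> > 0\<close> \<open>\<beta> > 0\<close> h1 fpos[of \<alpha>] fpos[of \<beta>]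
        by cases (auto simp: k_def)
    next
      fix \<alpha> s t :: real
      assume *: "\<alpha> \<in> I" "0 \<le> s" "s \<le> 1" "0 \<le> t" "t \<le> 1" "s + t \<in> {1/2, 3/2}"
      then have "k s + k t \<le> k (s + t)"
        using super[of s t] by (auto simp: k_def)
      then show "(k s + k t) * f \<alpha> \<le> k (s + t) * f \<alpha>"
        using fpos[of \<alpha>] * by (intro mult_right_mono) auto
    qed (use xyz in auto)
    then show "f (sqrt (x * z)) + f (sqrt (y * z)) + f (sqrt (x * y))
        \<le> h (3/2) * f (root 3 (x * y * z)) + h (1/2) * (f x + f y + f z)"
      by (simp add: k_def)
  }
  {
    fix x y z
    assume hyp: "subadditive_on J h \<and> GtAh_concave_on I J h f" and xyz: "x \<in> I" "y \<in> I" "z \<in> I"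
    have sub: "h s + h t \<ge> h (s + t)" if "0 < s" "0 < t" "s + t \<le> 3/2" for s t
      using hyp J that unfolding subadditive_on_def by simp
    have conc: "f (\<alpha> powr s * \<beta> powr (1 - s)) \<ge> h s * f \<alpha> + h (1 - s) * f \<beta>"
      if "\<alpha> \<in> I" "\<beta> \<in> I" "0 < s" "s < 1" for \<alpha> \<beta> s
      using hyp J that unfolding GtAh_concave_on_def by simp
    have "(2 * h (1/2)) * f x \<le> 1 * f x"
      using conc[of x x "1/2"] xyz self[of x] by (simp add: algebra_simps)
    then have "2 * h (1/2) \<le> 1" using fpos[of x] xyz mult_le_cancel_right_pos by blast
    then have h1: "h 1 \<le> 1" using sub[of "1/2" "1/2"] by simp
    have "- f (sqrt (x * z)) + - f (sqrt (y * z)) + - f (sqrt (x * y))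
        \<le> k (3/2) * - f (root 3 (x * y * z)) + k (1/2) * (- f x + - f y + - f z)"
    proof (rule weighted_popoviciu_geometric[OF assms(1,2), where f = "\<lambda>u. - f u"])
      fix \<alpha> \<beta> s :: real assume *: "\<alpha> \<in> I" "\<beta> \<in> I" "0 \<le> s" "s \<le> 1"
      then have "\<alpha> > 0" "\<beta> > 0" using assms(2) by auto
      consider "s = 0" | "s = 1" | "0 < s" "s < 1" using * by linarith
      then show "- f (\<alpha> powr s * \<beta> powr (1 - s)) \<le> k s * - f \<alpha> + k (1 - s) * - f \<beta>"
        using * conc[of \<alpha> \<beta> s] \<open>\<alpha> > 0\<close> \<open>\<beta> > 0\<close> h1 fpos[of \<alpha>] fpos[of \<beta>]
        by cases (auto simp: k_def)
    next
      fix \<alpha> s t :: real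
      assume *: "\<alpha> \<in> I" "0 \<le> s" "s \<le> 1" "0 \<le> t" "t \<le> 1" "s + t \<in> {1/2, 3/2}"
      then have "k s + k t \<ge> k (s + t)"
        using sub[of s t] by (auto simp: k_def)
      then show "(k s + k t) * - f \<alpha> \<le> k (s + t) * - f \<alpha>"
        using fpos[of \<alpha>] * by (intro mult_right_mono_neg) auto
    qed (use xyz in auto)
    then show "f (sqrt (x * z)) + f (sqrt (y * z)) + f (sqrt (x * y))
        \<ge> h (3/2) * f (root 3 (x * y * z)) + h (1/2) * (f x + f y + f z)"
      by (simp add: k_def algebra_simps)
  }
qed

end
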